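(* Let $K$ be a field, let $G$ be a Cohen-Macaulay very well-covered finite simple graph without isolated vertices, and let $S$ be the polynomial ring over $K$ whose variables are the vertices of $G$. Then $$\dim S/I(G)^{[k]}=\frac{|V(G)|}{2}+k-1\quad\text{for all } 1\le k\le\nu(G).$$
   Context: $I(G)\subset S$ is the edge ideal of $G$, generated by the products $xy$ with $\{x,y\}\in E(G)$. $G$ is called Cohen-Macaulay if $S/I(G)$ is a Cohen-Macaulay ring. $G$ is unmixed (well-covered) if all minimal vertex covers of $G$ have the same size; $G$ is very well-covered if it is unmixed and $\mathrm{height}\, I(G)=|V(G)|/2$. A matching of $G$ is a set of pairwise disjoint edges; $\nu(G)$ is the maximum size of a matching. The $k$th matching power $I(G)^{[k]}$ is the ideal of $S$ generated by all products $u_1\cdots u_k$ where $u_1,\dots,u_k$ are minimal monomial generators of $I(G)$ with pairwise disjoint supports, i.e. by the products of the variables in the vertex sets of the $k$-matchings of $G$. *)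

theory Defs
  imports
    "HOL-Algebra.Algebraic_Closure_Type"
    "HOL-Algebra.Ring_Divisibility"
    "HOL-Library.Cardinality"
    "HOL-Library.Poly_Mapping"
    "HOL-Library.Extended_Real"
begin

section \<open>Dimension and height\<close>

text \<open>
  Dimension, height and depth are suprema in \<^typ>\<open>ereal\<close>, so the zero ring, which has no
  prime ideal, has dimension \<open>-\<infinity>\<close>.
\<close>

definition prime_chain :: "('a, 'b) ring_scheme \<Rightarrow> nat \<Rightarrow> (nat \<Rightarrow> 'a set) \<Rightarrow> bool" where
  "prime_chain R n P \<longleftrightarrow> (\<forall>i\<le>n. primeideal (P i) R) \<and> (\<forall>i<n. P i \<subset> P (Suc i))"

definition krull_dim :: "('a, 'b) ring_scheme \<Rightarrow> ereal" where
  "krull_dim R = Sup {ereal (real n) | n. \<exists>P. prime_chain R n P}"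

definition prime_height :: "('a, 'b) ring_scheme \<Rightarrow> 'a set \<Rightarrow> ereal" where
  "prime_height R Q = Sup {ereal (real n) | n. \<exists>P. prime_chain R n P \<and> P n = Q}"

definition ideal_height :: "('a, 'b) ring_scheme \<Rightarrow> 'a set \<Rightarrow> ereal" where
  "ideal_height R I = Inf {prime_height R Q | Q. primeideal Q R \<and> I \<subseteq> Q}"


section \<open>Localization\<close>

text \<open>
  The ring of fractions of \<open>R\<close> with denominators in the multiplicative set \<open>T\<close>. The factor \<open>u\<close>
  is needed because \<open>T\<close> may contain zero divisors.
\<close>

definition frac_rel ::
    "('a, 'b) ring_scheme \<Rightarrow> 'a set \<Rightarrow> (('a \<times> 'a) \<times> ('a \<times> 'a)) set" where
  "frac_rel R T = {((a, s), (b, t)). a \<in> carrier R \<and> s \<in> T \<and> b \<in> carrier R \<and> t \<in> T \<and>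
     (\<exists>u\<in>T. u \<otimes>\<^bsub>R\<^esub> (t \<otimes>\<^bsub>R\<^esub> a) = u \<otimes>\<^bsub>R\<^esub> (s \<otimes>\<^bsub>R\<^esub> b))}"

definition fraction :: "('a, 'b) ring_scheme \<Rightarrow> 'a set \<Rightarrow> 'a \<Rightarrow> 'a \<Rightarrow> ('a \<times> 'a) set" where
  "fraction R T a s = frac_rel R T `` {(a, s)}"

definition localization ::
    "('a, 'b) ring_scheme \<Rightarrow> 'a set \<Rightarrow> ('a \<times> 'a) set ring" where
  "localization R T = \<lparr>
     carrier = (carrier R \<times> T) // frac_rel R T,
     monoid.mult = (\<lambda>A B. \<Union>(a, s)\<in>A. \<Union>(b, t)\<in>B. fraction R T (a \<otimes>\<^bsub>R\<^esub> b) (s \<otimes>\<^bsub>R\<^esub> t)),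
     one = fraction R T \<one>\<^bsub>R\<^esub> \<one>\<^bsub>R\<^esub>,
     ring.zero = fraction R T \<zero>\<^bsub>R\<^esub> \<one>\<^bsub>R\<^esub>,
     add = (\<lambda>A B. \<Union>(a, s)\<in>A. \<Union>(b, t)\<in>B.
       fraction R T ((t \<otimes>\<^bsub>R\<^esub> a) \<oplus>\<^bsub>R\<^esub> (s \<otimes>\<^bsub>R\<^esub> b)) (s \<otimes>\<^bsub>R\<^esub> t))\<rparr>"


section \<open>Cohen-Macaulay rings\<close>

text \<open>
  In the following condition on \<open>i\<close>, the element \<open>xs ! i\<close> is a non-zero-divisor modulo the ideal
  generated by its predecessors.
\<close>

definition regular_sequence :: "('a, 'b) ring_scheme \<Rightarrow> 'a list \<Rightarrow> bool" where
  "regular_sequence R xs \<longleftrightarrow> set xs \<subseteq> carrier R \<and> Idl\<^bsub>R\<^esub> (set xs) \<noteq> carrier R \<and>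
     (\<forall>i<length xs. \<forall>a\<in>carrier R.
        xs ! i \<otimes>\<^bsub>R\<^esub> a \<in> Idl\<^bsub>R\<^esub> (set (take i xs)) \<longrightarrow> a \<in> Idl\<^bsub>R\<^esub> (set (take i xs)))"

definition depth :: "('a, 'b) ring_scheme \<Rightarrow> 'a set \<Rightarrow> ereal" where
  "depth R I = Sup {ereal (real (length xs)) | xs. regular_sequence R xs \<and> set xs \<subseteq> I}"

definition cohen_macaulay_local :: "('a, 'b) ring_scheme \<Rightarrow> bool" where
  "cohen_macaulay_local R \<longleftrightarrow> cring R \<and> noetherian_ring R \<and>
     (\<exists>M. {N. maximalideal N R} = {M} \<and> depth R M = krull_dim R)"

definition cohen_macaulay :: "('a, 'b) ring_scheme \<Rightarrow> bool" where
  "cohen_macaulay R \<longleftrightarrow> cring R \<and> noetherian_ring R \<and>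
     (\<forall>M. maximalideal M R \<longrightarrow> cohen_macaulay_local (localization R (carrier R - M)))"


section \<open>Graphs\<close>

text \<open>
  The vertex set of a graph is the whole of a finite type \<open>'v\<close>; a graph is given by its set of
  edges.
\<close>

definition simple_graph :: "'v::finite set set \<Rightarrow> bool" where
  "simple_graph E \<longleftrightarrow> (\<forall>e\<in>E. card e = 2)"

definition isolated_vertex :: "'v::finite set set \<Rightarrow> 'v \<Rightarrow> bool" where
  "isolated_vertex E v \<longleftrightarrow> (\<forall>e\<in>E. v \<notin> e)"

definition vertex_cover :: "'v::finite set set \<Rightarrow> 'v set \<Rightarrow> bool" where
  "vertex_cover E C \<longleftrightarrow> (\<forall>e\<in>E. e \<inter> C \<noteq> {})"

definition minimal_vertex_cover :: "'v::finite set set \<Rightarrow> 'v set \<Rightarrow> bool" where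
  "minimal_vertex_cover E C \<longleftrightarrow> vertex_cover E C \<and> (\<forall>D. D \<subset> C \<longrightarrow> \<not> vertex_cover E D)"

definition unmixed :: "'v::finite set set \<Rightarrow> bool" where
  "unmixed E \<longleftrightarrow>
     (\<forall>C D. minimal_vertex_cover E C \<and> minimal_vertex_cover E D \<longrightarrow> card C = card D)"

definition matching :: "'v::finite set set \<Rightarrow> 'v set set \<Rightarrow> bool" where
  "matching E M \<longleftrightarrow> M \<subseteq> E \<and> pairwise disjnt M"

definition matching_number :: "'v::finite set set \<Rightarrow> nat" where
  "matching_number E = Max {card M | M. matching E M}"


section \<open>Edge ideals and matching powers\<close>

text \<open>
  Polynomials with coefficients in \<open>'k\<close> and with the elements of \<open>'v\<close> as variables: an exponent
  vector is a map \<open>'v \<Rightarrow>\<^sub>0 nat\<close>, and a polynomial assigns coefficients to finitely many of them.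
  The arguments of type \<open>'k itself\<close> below fix the coefficient field.
\<close>

type_synonym ('v, 'k) mpoly = "('v \<Rightarrow>\<^sub>0 nat) \<Rightarrow>\<^sub>0 'k"

abbreviation mpoly_ring :: "'k::field itself \<Rightarrow> ('v::finite, 'k) mpoly ring" where
  "mpoly_ring K \<equiv> ring_of_type_algebra"

definition mvar :: "'v::finite \<Rightarrow> ('v, 'k::field) mpoly" where
  "mvar v = Poly_Mapping.single (Poly_Mapping.single v 1) 1"

definition edge_monomial :: "'v::finite set \<Rightarrow> ('v, 'k::field) mpoly" where
  "edge_monomial e = (\<Prod>v\<in>e. mvar v)"

definition edge_ideal :: "'k::field itself \<Rightarrow> 'v::finite set set \<Rightarrow> ('v, 'k) mpoly set" where
  "edge_ideal K E = Idl\<^bsub>mpoly_ring K\<^esub> (edge_monomial ` E)"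

text \<open>
  The minimal monomial generators of the edge ideal are the edge monomials, so \<open>k\<close> of them with
  pairwise disjoint supports are the edge monomials of a \<open>k\<close>-matching.
\<close>

definition matching_power ::
    "'k::field itself \<Rightarrow> 'v::finite set set \<Rightarrow> nat \<Rightarrow> ('v, 'k) mpoly set" where
  "matching_power K E k =
     Idl\<^bsub>mpoly_ring K\<^esub> {\<Prod>e\<in>M. edge_monomial e | M. matching E M \<and> card M = k}"

definition cohen_macaulay_graph :: "'k::field itself \<Rightarrow> 'v::finite set set \<Rightarrow> bool" where
  "cohen_macaulay_graph K E \<longleftrightarrow> cohen_macaulay (mpoly_ring K Quot edge_ideal K E)"

definition very_well_covered :: "'k::field itself \<Rightarrow> 'v::finite set set \<Rightarrow> bool" where
  "very_well_covered K E \<longleftrightarrow> unmixed E \<and>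
     ideal_height (mpoly_ring K) (edge_ideal K E) = ereal (real CARD('v) / 2)"

end

theory Submission
  imports Defs
begin

text \<open>
  Let \<open>2n\<close> be the number of vertices. A monomial prime generated by variables outside \<open>W\<close> contains
  the \<open>k\<close>th matching power iff \<open>W\<close> contains no \<open>k\<close>-matching, so the dimension is the largest size of
  such a \<open>W\<close>. An independent set of size \<open>n\<close> enlarged by \<open>k - 1\<close> vertices contains no \<open>k\<close>-matching,
  because every edge meets the added vertices. Conversely, in a well-covered graph without isolated
  vertices independent sets satisfy Hall's condition, so the height assumption yields a perfect
  matching; a set of \<open>n + k\<close> vertices misses only \<open>n - k\<close> others and so contains \<open>k\<close> of its edges.
  The length of prime chains is bounded by algebraic dependence, which gives both the height of the
  edge ideal and the dimension of the quotients.
\<close>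

section \<open>Matchings in well-covered graphs\<close>

text \<open>Induction on \<open>card A\<close>. If some nonempty proper subset \<open>Z\<close> is
  tight, it is matched on its own and the rest is matched outside the neighbourhood of
  \<open>Z\<close>. If there is none, every such subset has one neighbour to spare, so any single
  pair can be fixed first.\<close>

lemma hall_marriage:
  assumes "finite A" "\<And>a. a \<in> A \<Longrightarrow> finite (N a)"
    and "\<And>Z. Z \<subseteq> A \<Longrightarrow> card Z \<le> card (\<Union>(N ` Z))"
  shows "\<exists>f. inj_on f A \<and> (\<forall>a\<in>A. f a \<in> N a)"
  using assms
proof (induction "card A" arbitrary: A N rule: less_induct)
  case less
  note fin = less.prems(1,2) and hall = less.prems(3)
  show ?case
  proof (cases "\<exists>Z. Z \<noteq> {} \<and> Z \<subset> A \<and> card (\<Union>(N ` Z)) = card Z")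
    case True
    then obtain Z where Z: "Z \<noteq> {}" "Z \<subset> A" "card (\<Union>(N ` Z)) = card Z"
      by blast
    have finX: "finite Z" and finU: "finite (\<Union>(N ` Z))"
      using Z(2) fin by (metis finite_subset psubset_imp_subset, metis finite_UN finite_subset psubset_imp_subset subsetD)
    have "\<exists>f. inj_on f Z \<and> (\<forall>a\<in>Z. f a \<in> N a)"
      using Z(2) fin hall by (intro less.hyps psubset_card_mono) (auto intro: finite_subset[of _ A])
    then obtain f where f: "inj_on f Z" "\<forall>a\<in>Z. f a \<in> N a" by blast
    have "\<exists>g. inj_on g (A - Z) \<and> (\<forall>a\<in>A - Z. g a \<in> N a - \<Union>(N ` Z))"
    proof (rule less.hyps)
      show "card (A - Z) < card A"
        using Z fin by (intro psubset_card_mono) auto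
      fix Y assume Y: "Y \<subseteq> A - Z"
      have finY: "finite Y" using Y fin finite_subset by blast
      \<comment> \<open>Hall's condition for \<open>Z \<union> Y\<close>, minus the tight equality
        for \<open>Z\<close>, is Hall's condition for \<open>Y\<close> in the reduced
        family.\<close>
      have "card (Z \<union> Y) \<le> card (\<Union>(N ` (Z \<union> Y)))"
        using Y Z by (intro hall) auto
      moreover have "card (Z \<union> Y) = card Z + card Y"
        using Y finX finY by (intro card_Un_disjoint) auto
      moreover have "\<Union>(N ` (Z \<union> Y)) = \<Union>(N ` Z) \<union> \<Union>((\<lambda>y. N y - \<Union>(N ` Z)) ` Y)"
        by auto
      moreover have "card (\<Union>(N ` Z) \<union> \<Union>((\<lambda>y. N y - \<Union>(N ` Z)) ` Y))
          \<le> card (\<Union>(N ` Z)) + card (\<Union>((\<lambda>y. N y - \<Union>(N ` Z)) ` Y))"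
        by (rule card_Un_le)
      ultimately show "card Y \<le> card (\<Union>y\<in>Y. N y - \<Union>(N ` Z))"
        using Z(3) by simp
    qed (use fin in auto)
    then obtain g where g: "inj_on g (A - Z)" "\<forall>a\<in>A - Z. g a \<in> N a - \<Union>(N ` Z)"
      by blast
    have "inj_on (\<lambda>a. if a \<in> Z then f a else g a) A"
      using f g unfolding inj_on_def by (smt (verit, best) DiffD2 DiffI UN_I)
    then show ?thesis
      using f g by (intro exI[of _ "\<lambda>a. if a \<in> Z then f a else g a"]) auto
  next
    case False
    show ?thesis
    proof (cases "A = {}")
      case False
      then obtain a where a: "a \<in> A" by blast
      have "N a \<noteq> {}" using hall[of "{a}"] a by auto
      then obtain b where b: "b \<in> N a" by blast
      have "\<exists>g. inj_on g (A - {a}) \<and> (\<forall>x\<in>A - {a}. g x \<in> N x - {b})"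
      proof (rule less.hyps)
        show "card (A - {a}) < card A"
          using a fin by (intro psubset_card_mono) auto
        fix Y assume Y: "Y \<subseteq> A - {a}"
        have eq: "(\<Union>x\<in>Y. N x - {b}) = \<Union>(N ` Y) - {b}" by auto
        show "card Y \<le> card (\<Union>x\<in>Y. N x - {b})"
        proof (cases "Y = {}")
          case False
          have "card Y \<le> card (\<Union>(N ` Y))" using Y by (intro hall) auto
          \<comment> \<open>\<open>Y\<close> omits \<open>a\<close>, so it is a nonempty proper
            subset and not tight; the surplus makes up for the deleted \<open>b\<close>.\<close>
          moreover have "card (\<Union>(N ` Y)) \<noteq> card Y"
            using \<open>\<not> (\<exists>Z. Z \<noteq> {} \<and> Z \<subset> A \<and> card (\<Union>(N ` Z)) = card Z)\<close> False Y a by blast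
          moreover have "card (\<Union>(N ` Y)) - 1 \<le> card (\<Union>(N ` Y) - {b})"
            by (metis card.empty card_Diff_singleton_if diff_le_self order_refl)
          ultimately show ?thesis unfolding eq by linarith
        qed auto
      qed (use fin in auto)
      then obtain g where g: "inj_on g (A - {a})" "\<forall>x\<in>A - {a}. g x \<in> N x - {b}"
        by blast
      have "inj_on (g(a := b)) A"
      proof (rule inj_onI)
        fix x y assume "x \<in> A" "y \<in> A" "(g(a := b)) x = (g(a := b)) y"
        then show "x = y"
          using g by (cases "x = a"; cases "y = a") (auto dest: inj_onD)
      qed
      then show ?thesis
        using g b by (intro exI[of _ "g(a := b)"]) auto
    qed auto
  qed
qed

section \<open>Vertex covers, independent sets and matchings\<close>

lemma card_Compl: "card (- A) = CARD('a) - card A" for A :: "'a::finite set"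
  by (simp add: Compl_eq_Diff_UNIV card_Diff_subset)

lemma vertex_cover_Compl_iff: "vertex_cover E (- S) \<longleftrightarrow> (\<forall>e\<in>E. \<not> e \<subseteq> S)"
  unfolding vertex_cover_def by auto

lemma minimal_vertex_cover_within:
  assumes "vertex_cover E C"
  obtains D where "D \<subseteq> C" "minimal_vertex_cover E D"
proof -
  have "\<exists>D. D \<subseteq> C \<and> minimal_vertex_cover E D"
    using finite[of C] assms
  proof (induction C rule: finite_psubset_induct)
    case (psubset C)
    then show ?case
      unfolding minimal_vertex_cover_def by (meson psubset_imp_subset subset_refl subset_trans)
  qed
  then show ?thesis using that by blast
qed

definition neighbours :: "'v::finite set set \<Rightarrow> 'v set \<Rightarrow> 'v set" where
  "neighbours E S = {w. \<exists>v\<in>S. {v, w} \<in> E}"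

lemma edgeE:
  assumes "simple_graph E" "e \<in> E" "v \<in> e"
  obtains w where "e = {v, w}" "w \<noteq> v"
  using assms unfolding simple_graph_def card_2_iff by (metis insertE insert_commute singletonD)

lemma well_covered_card_le_neighbours:
  fixes E :: "'v::finite set set"
  assumes simple: "simple_graph E" and no_iso: "\<And>v. \<not> isolated_vertex E v"
    and unm: "unmixed E" and indep: "vertex_cover E (- S)"
  shows "card S \<le> card (neighbours E S)"
  \<comment> \<open>For a vertex \<open>v\<close> of \<open>S\<close> take a maximal independent set \<open>A\<close> avoiding \<open>v\<close>. As all maximal
     independent sets have the same size, exchanging \<open>A \<inter> neighbours E S\<close> for \<open>S - A\<close> in \<open>A\<close> cannot
     enlarge it; what is left is the claim for the smaller set \<open>A \<inter> S\<close>.\<close>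
  using finite[of S] indep
proof (induction S rule: finite_psubset_induct)
  case (psubset S)
  show ?case
  proof (cases "S = {}")
    case False
    then obtain v where v: "v \<in> S" by blast
    obtain e where "e \<in> E" "v \<in> e"
      using no_iso[of v] unfolding isolated_vertex_def by blast
    then obtain w where w: "{v, w} \<in> E" "w \<noteq> v"
      using edgeE[OF simple] by metis
    \<comment> \<open>A maximal independent set through the neighbour \<open>w\<close> of
      \<open>v\<close> must avoid \<open>v\<close>. It is obtained as the complement of a minimal
      vertex cover inside \<open>- {w}\<close>.\<close>
    have "vertex_cover E (- {w})"
      unfolding vertex_cover_Compl_iff using simple unfolding simple_graph_def
      by (metis card_1_singleton_iff card.empty card_2_iff doubleton_eq_iff subset_singletonD
          insert_not_empty singleton_insert_inj_eq')
    then obtain D where D: "D \<subseteq> - {w}" "minimal_vertex_cover E D"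
      by (rule minimal_vertex_cover_within)
    define A where "A = - D"
    have A: "w \<in> A" "vertex_cover E (- A)"
      using D unfolding A_def minimal_vertex_cover_def by auto
    have vA: "v \<notin> A"
      using A w unfolding vertex_cover_Compl_iff by auto
    have IH: "card (A \<inter> S) \<le> card (neighbours E (A \<inter> S))"
    proof (rule psubset.IH)
      show "A \<inter> S \<subset> S" using v vA by blast
      show "vertex_cover E (- (A \<inter> S))"
        using psubset.prems unfolding vertex_cover_Compl_iff by auto
    qed
    define B where "B = (A - neighbours E S) \<union> S"
    \<comment> \<open>An edge inside \<open>B\<close> is not inside the independent set
      \<open>A\<close>, so it has an end in \<open>S\<close>. Its other end is then a neighbour of
      \<open>S\<close>, hence also in \<open>S\<close>, although \<open>S\<close> is
      independent.\<close>
    have "vertex_cover E (- B)"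
      unfolding vertex_cover_Compl_iff
    proof (intro ballI notI)
      fix e assume e: "e \<in> E" "e \<subseteq> B"
      obtain x where x: "x \<in> e" "x \<notin> A - neighbours E S"
        using A(2) e unfolding vertex_cover_Compl_iff by blast
      then have xS: "x \<in> S" using e unfolding B_def by auto
      obtain y where y: "e = {x, y}" using edgeE[OF simple e(1) x(1)] by metis
      have "y \<in> neighbours E S" using xS y e(1) unfolding neighbours_def by blast
      then have "y \<in> S" using e y unfolding B_def by auto
      then show False
        using psubset.prems e(1) xS y unfolding vertex_cover_Compl_iff by auto
    qed
    then obtain D' where D': "D' \<subseteq> - B" "minimal_vertex_cover E D'"
      by (rule minimal_vertex_cover_within)
    have "card B \<le> card (- D')" using D' by (intro card_mono) auto
    also have "\<dots> = card A"
      using unm D D' unfolding unmixed_def A_def by (metis card_Compl)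
    finally have BA: "card B \<le> card A" .
    have disj: "S \<inter> neighbours E S = {}"
      using psubset.prems unfolding vertex_cover_Compl_iff neighbours_def by auto
    have "card B = card (A - neighbours E S - S) + card S"
      unfolding B_def by (subst card_Un_disjoint[symmetric]) (auto intro: arg_cong[where f = card])
    moreover have "card A = card (A - neighbours E S - S) + card (A \<inter> neighbours E S) + card (A \<inter> S)"
      using disj
      by (subst card_Un_disjoint[symmetric] | (subst card_Un_disjoint[symmetric])?;
          auto intro: arg_cong[where f = card])+
    ultimately have "card S \<le> card (A \<inter> neighbours E S) + card (A \<inter> S)"
      using BA by linarith
    also have "\<dots> \<le> card (A \<inter> neighbours E S) + card (neighbours E (A \<inter> S))"
      using IH by simp
    \<comment> \<open>As \<open>A\<close> is independent, no neighbour of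
      \<open>A \<inter> S\<close> lies in \<open>A\<close>, so the two sets are disjoint.\<close>
    also have "\<dots> = card (A \<inter> neighbours E S \<union> neighbours E (A \<inter> S))"
      using A(2) unfolding vertex_cover_Compl_iff neighbours_def
      by (intro card_Un_disjoint[symmetric]) auto
    also have "\<dots> \<le> card (neighbours E S)"
      unfolding neighbours_def by (intro card_mono) auto
    finally show ?thesis .
  qed auto
qed

text \<open>Choosing a point of \<open>B\<close> in each edge is injective because the edges of a
  matching are disjoint.\<close>

lemma card_matching_le_transversal:
  assumes "matching E M" "\<And>e. e \<in> M \<Longrightarrow> e \<inter> B \<noteq> {}"
  shows "card M \<le> card (B :: 'v::finite set)"
proof -
  have "\<forall>e\<in>M. \<exists>v. v \<in> e \<inter> B" using assms(2) by blast
  then obtain g where g: "\<And>e. e \<in> M \<Longrightarrow> g e \<in> e \<inter> B" by metis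
  have "inj_on g M"
    using assms(1) g unfolding matching_def pairwise_def disjnt_def inj_on_def
    by (metis IntD1 IntI empty_iff)
  then show ?thesis
    using g by (intro card_inj_on_le[of g]) auto
qed

lemma matching_number_le_vertex_cover:
  assumes "vertex_cover E C"
  shows "matching_number E \<le> card C"
proof -
  have "matching_number E \<in> {card M | M. matching E M}"
    unfolding matching_number_def
  proof (rule Max_in)
    show "{card M | M. matching E M} \<noteq> {}"
      by (auto simp: matching_def intro!: exI[of _ "{}"])
  qed auto
  then obtain M where "matching E M" "matching_number E = card M" by blast
  then show ?thesis
    using assms card_matching_le_transversal[of E M C]
    unfolding vertex_cover_def matching_def by (metis subsetD)
qed

text \<open>Hall's theorem matches the independent set \<open>- C\<close> into \<open>C\<close>, and
  equal sizes make this matching perfect. At most \<open>card C - k\<close> vertices lie outside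
  \<open>W\<close>, and each of them spoils at most one of the \<open>card C\<close> edges.\<close>

lemma well_covered_matching_within:
  fixes E :: "'v::finite set set"
  assumes simple: "simple_graph E" and no_iso: "\<And>v. \<not> isolated_vertex E v"
    and unm: "unmixed E" and C: "vertex_cover E C" "2 * card C = CARD('v)"
    and W: "card C + k \<le> card W"
  obtains M where "matching E M" "card M = k" "\<Union>M \<subseteq> W"
proof -
  define A where "A = - C"
  have cA: "card A = card C"
    using C(2) unfolding A_def by (simp add: card_Compl)
  have indep: "vertex_cover E (- A)" using C A_def by simp
  have "\<exists>f. inj_on f A \<and> (\<forall>a\<in>A. f a \<in> neighbours E {a})"
  proof (rule hall_marriage)
    fix Z assume "Z \<subseteq> A"
    then have "vertex_cover E (- Z)" using indep unfolding vertex_cover_Compl_iff by blast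
    moreover have "(\<Union>a\<in>Z. neighbours E {a}) = neighbours E Z"
      unfolding neighbours_def by auto
    ultimately show "card Z \<le> card (\<Union>a\<in>Z. neighbours E {a})"
      using well_covered_card_le_neighbours[OF simple no_iso unm] by simp
  qed auto
  then obtain f where f: "inj_on f A" "\<And>a. a \<in> A \<Longrightarrow> {a, f a} \<in> E"
    unfolding neighbours_def by auto
  have fA: "f a \<notin> A" if "a \<in> A" for a
    using f(2)[OF that] that indep unfolding vertex_cover_Compl_iff by auto
  define A' where "A' = {a \<in> A. a \<in> W \<and> f a \<in> W}"
  \<comment> \<open>Each matching edge not inside \<open>W\<close> is charged to one of its ends
    outside \<open>W\<close>. Values of \<open>f\<close> lie outside \<open>A\<close>, so the two
    kinds of ends never coincide.\<close>
  have "inj_on (\<lambda>a. if a \<in> W then f a else a) (A - A')"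
  proof (rule inj_onI)
    fix a b assume "a \<in> A - A'" "b \<in> A - A'" "(if a \<in> W then f a else a) = (if b \<in> W then f b else b)"
    then show "a = b"
      using f(1) fA[of a] fA[of b] by (auto split: if_splits dest: inj_onD)
  qed
  then have "card (A - A') \<le> card (- W)"
    by (rule card_inj_on_le) (auto simp: A'_def)
  moreover have "card (A - A') = card A - card A'"
    by (intro card_Diff_subset) (auto simp: A'_def)
  moreover have "card (- W) = CARD('v) - card W"
    by (simp add: card_Compl)
  moreover have "card W \<le> CARD('v)" by (rule card_mono) auto
  ultimately have "k \<le> card A'" using W C(2) cA by linarith
  then obtain B where B: "B \<subseteq> A'" "card B = k"
    by (metis obtain_subset_with_card_n)
  have BA: "b \<in> A" if "b \<in> B" for b using that B A'_def by auto
  have inj: "inj_on (\<lambda>a. {a, f a}) B"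
    using fA BA unfolding inj_on_def by (metis doubleton_eq_iff)
  have "matching E ((\<lambda>a. {a, f a}) ` B)"
    using f fA BA unfolding matching_def pairwise_def disjnt_def
    by (auto dest: inj_onD)
  moreover have "card ((\<lambda>a. {a, f a}) ` B) = k"
    using inj B by (simp add: card_image)
  moreover have "\<Union>((\<lambda>a. {a, f a}) ` B) \<subseteq> W"
    using B unfolding A'_def by auto
  ultimately show ?thesis by (rule that)
qed

lemma no_matching_within_enlarged_independent_set:
  fixes E :: "'v::finite set set"
  assumes C: "vertex_cover E C" and k: "1 \<le> k" "k \<le> matching_number E"
  obtains W where "card W = card (- C) + k - 1"
    "\<And>M. matching E M \<Longrightarrow> card M = k \<Longrightarrow> \<not> \<Union>M \<subseteq> W"
proof -
  \<comment> \<open>The upper bound on \<open>k\<close> guarantees that the cover has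
    \<open>k - 1\<close> vertices to add to its complement.\<close>
  have "k - 1 \<le> card C" using matching_number_le_vertex_cover[OF C] k by linarith
  then obtain B where B: "B \<subseteq> C" "card B = k - 1"
    by (metis obtain_subset_with_card_n)
  show ?thesis
  proof (rule that[of "- C \<union> B"])
    have "card (- C \<union> B) = card (- C) + card B"
      using B by (intro card_Un_disjoint) auto
    then show "card (- C \<union> B) = card (- C) + k - 1" using B k by simp
    fix M assume M: "matching E M" "card M = k"
    show "\<not> \<Union>M \<subseteq> - C \<union> B"
    proof
      assume sub: "\<Union>M \<subseteq> - C \<union> B"
      have "card M \<le> card B"
      proof (rule card_matching_le_transversal[OF M(1)])
        fix e assume "e \<in> M"
        then show "e \<inter> B \<noteq> {}"
          using C M sub unfolding vertex_cover_def matching_def by blast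
      qed
      then show False using B M k by linarith
    qed
  qed
qed


section \<open>Relations along chains of prime ideals\<close>

text \<open>Gaussian elimination: an equation with a nonzero coefficient at \<open>p\<close> is
  solved for the unknown \<open>p\<close> and substituted into the others, which removes one
  equation and one unknown. This later yields the linear dependence that bounds chains of
  primes.\<close>

lemma homogeneous_system_nontrivial_solution:
  fixes a :: "'j \<Rightarrow> 'i \<Rightarrow> 'k::field"
  assumes "finite J" "finite I" "card J < card I"
  shows "\<exists>c. (\<exists>i\<in>I. c i \<noteq> 0) \<and> (\<forall>j\<in>J. (\<Sum>i\<in>I. a j i * c i) = 0)"
  using assms
proof (induction J arbitrary: I a rule: finite_induct)
  case empty
  then show ?case by (auto intro!: exI[of _ "\<lambda>_. 1"] simp: card_gt_0_iff)
next
  case (insert j J)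
  show ?case
  proof (cases "\<forall>i\<in>I. a j i = 0")
    case True
    have "card J < card I" using insert by simp
    from insert.IH[OF insert.prems(1) this, of a] True show ?thesis by auto
  next
    case False
    then obtain p where p: "p \<in> I" "a j p \<noteq> 0" by blast
    define I' where "I' = I - {p}"
    have I: "I = insert p I'" "p \<notin> I'" "finite I'"
      using p insert.prems by (auto simp: I'_def)
    have "card J < card I'"
      using insert.prems insert.hyps I by simp
    from insert.IH[OF I(3) this, of "\<lambda>l i. a l i - a l p * a j i / a j p"]
    obtain c where c: "\<exists>i\<in>I'. c i \<noteq> 0"
      and c0: "\<And>l. l \<in> J \<Longrightarrow> (\<Sum>i\<in>I'. (a l i - a l p * a j i / a j p) * c i) = 0"
      by blast
    define s where "s = (\<Sum>i\<in>I'. a j i * c i)"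
    \<comment> \<open>The value at \<open>p\<close> is the one forced by equation
      \<open>j\<close>.\<close>
    define d where "d = c(p := - s / a j p)"
    have sum_d: "(\<Sum>i\<in>I. a l i * d i) = a l p * (- s / a j p) + (\<Sum>i\<in>I'. a l i * c i)" for l
    proof -
      have "(\<Sum>i\<in>I'. a l i * d i) = (\<Sum>i\<in>I'. a l i * c i)"
        using I(2) by (intro sum.cong) (auto simp: d_def)
      then show ?thesis using I by (simp add: d_def)
    qed
    have "(\<Sum>i\<in>I. a l i * d i) = 0" if "l \<in> insert j J" for l
    proof (cases "l = j")
      case True
      then show ?thesis using p by (simp add: sum_d s_def)
    next
      case False
      then have "l \<in> J" using that by simp
      have "(\<Sum>i\<in>I'. (a l i - a l p * a j i / a j p) * c i)
          = (\<Sum>i\<in>I'. a l i * c i) - a l p / a j p * s"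
        unfolding s_def sum_distrib_left sum_subtractf[symmetric]
        by (intro sum.cong) (auto simp: algebra_simps)
      then show ?thesis using c0[OF \<open>l \<in> J\<close>] by (simp add: sum_d)
    qed
    moreover have "\<exists>i\<in>I. d i \<noteq> 0"
      using c I by (auto simp: d_def)
    ultimately show ?thesis by blast
  qed
qed

text \<open>
  Prime ideals of \<^term>\<open>ring_of_type_algebra\<close> in terms of the type class operations.
\<close>

definition prime_set :: "'a::comm_ring_1 set \<Rightarrow> bool" where
  "prime_set P \<longleftrightarrow> 0 \<in> P \<and> 1 \<notin> P \<and> (\<forall>x\<in>P. \<forall>y\<in>P. x + y \<in> P) \<and> (\<forall>x\<in>P. \<forall>y. x * y \<in> P)
     \<and> (\<forall>x y. x * y \<in> P \<longrightarrow> x \<in> P \<or> y \<in> P)"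

lemma
  assumes "prime_set P"
  shows prime_set_zero: "0 \<in> P" and prime_set_one: "1 \<notin> P"
    and prime_set_add: "x \<in> P \<Longrightarrow> y \<in> P \<Longrightarrow> x + y \<in> P"
    and prime_set_mult_right: "x \<in> P \<Longrightarrow> x * y \<in> P"
    and prime_set_mult_left: "y \<in> P \<Longrightarrow> x * y \<in> P"
    and prime_set_mult_iff: "x * y \<in> P \<longleftrightarrow> x \<in> P \<or> y \<in> P"
    and prime_set_minus: "x \<in> P \<Longrightarrow> y \<in> P \<Longrightarrow> x - y \<in> P"
    and prime_set_power: "x \<notin> P \<Longrightarrow> x ^ n \<notin> P"
    and prime_set_sum: "(\<And>i. i \<in> I \<Longrightarrow> f i \<in> P) \<Longrightarrow> sum f I \<in> P"
    and prime_set_prod_iff: "finite I \<Longrightarrow> prod f I \<in> P \<longleftrightarrow> (\<exists>i\<in>I. f i \<in> P)"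
proof -
  show 0: "0 \<in> P" and 1: "1 \<notin> P" using assms unfolding prime_set_def by auto
  show add: "x + y \<in> P" if "x \<in> P" "y \<in> P" for x y
    using assms that unfolding prime_set_def by blast
  show mr: "x * y \<in> P" if "x \<in> P" for x y
    using assms that unfolding prime_set_def by blast
  show ml: "x * y \<in> P" if "y \<in> P" for x y
    using mr[OF that, of x] by (simp add: mult.commute)
  show iff: "x * y \<in> P \<longleftrightarrow> x \<in> P \<or> y \<in> P" for x y
    using assms mr ml unfolding prime_set_def by blast
  show "x - y \<in> P" if "x \<in> P" "y \<in> P" for x y
    using add[OF that(1) mr[OF that(2), of "-1"]] by simp
  show "x ^ n \<notin> P" if "x \<notin> P"
    using that 1 by (induction n) (auto simp: iff)
  show "sum f I \<in> P" if "\<And>i. i \<in> I \<Longrightarrow> f i \<in> P"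
    using that by (induction I rule: infinite_finite_induct) (auto intro: 0 add)
  show "prod f I \<in> P \<longleftrightarrow> (\<exists>i\<in>I. f i \<in> P)" if "finite I"
    using that by (induction I rule: finite_induct) (auto simp: iff 1)
qed

text \<open>
  Divide the relation by the lowest power \<open>t\<close> of \<open>x 0\<close> occurring in it. As \<open>x 0\<close> is not in \<open>P 0\<close>, the
  quotient still lies in \<open>P 0\<close>, and modulo \<open>P 1\<close> it is a shorter relation among the remaining \<open>x i\<close>.
\<close>

lemma prime_chain_no_relation:
  fixes P :: "nat \<Rightarrow> 'a::comm_ring_1 set" and x :: "nat \<Rightarrow> 'a"
  assumes "\<And>i. i \<le> m \<Longrightarrow> prime_set (P i)" "\<And>i. i < m \<Longrightarrow> P i \<subseteq> P (Suc i)"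
    and "\<And>i. i < m \<Longrightarrow> x i \<in> P (Suc i) - P i"
    and "finite F" "F \<noteq> {}" "\<And>e. e \<in> F \<Longrightarrow> length e = m"
    and "\<And>e. e \<in> F \<Longrightarrow> c e dvd 1"
  shows "(\<Sum>e\<in>F. c e * (\<Prod>i<m. x i ^ (e ! i))) \<notin> P 0"
  using assms
proof (induction m arbitrary: P x F c)
  case 0
  then have "F = {[]}" by auto
  have "prime_set (P 0)" "c [] dvd 1" using 0 \<open>F = {[]}\<close> by auto
  then have "c [] \<notin> P 0"
    by (metis dvdE prime_set_mult_right prime_set_one)
  then show ?case using \<open>F = {[]}\<close> by simp
next
  case (Suc m)
  define t where "t = Min (hd ` F)"
  have t_le: "t \<le> hd e" if "e \<in> F" for e
    unfolding t_def using Suc.prems(4) that by (intro Min_le) auto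
  have "t \<in> hd ` F"
    unfolding t_def using Suc.prems(4,5) by (intro Min_in) auto
  \<comment> \<open>After division by \<open>x 0 ^ t\<close>, the terms from \<open>F0\<close> are
    free of \<open>x 0\<close> and form \<open>Q\<close>; the other terms form \<open>R\<close> and
    keep a positive power of \<open>x 0\<close>.\<close>
  define F0 where "F0 = {e \<in> F. hd e = t}"
  have F0: "F0 \<subseteq> F" "F0 \<noteq> {}" "finite F0"
    using \<open>t \<in> hd ` F\<close> Suc.prems(4) by (auto simp: F0_def)
  define y where "y e = (\<Prod>i<m. x (Suc i) ^ (tl e ! i))" for e :: "nat list"
  have prod_eq: "(\<Prod>i<Suc m. x i ^ (e ! i)) = x 0 ^ t * (x 0 ^ (hd e - t) * y e)"
    if "e \<in> F" for e
  proof -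
    have "length e = Suc m" using that by (rule Suc.prems(6))
    then obtain h l where e: "e = h # l" by (cases e) auto
    show ?thesis
      using t_le[OF that] unfolding prod.lessThan_Suc_shift y_def e
      by (simp add: mult.assoc[symmetric] power_add[symmetric])
  qed
  define R where "R = (\<Sum>e\<in>F - F0. c e * (x 0 ^ (hd e - t) * y e))"
  define Q where "Q = (\<Sum>e\<in>F0. c e * y e)"
  have "(\<Sum>e\<in>F. c e * (\<Prod>i<Suc m. x i ^ (e ! i)))
      = (\<Sum>e\<in>F. x 0 ^ t * (c e * (x 0 ^ (hd e - t) * y e)))"
    by (intro sum.cong refl) (simp add: prod_eq mult.left_commute del: prod.lessThan_Suc)
  also have "\<dots> = x 0 ^ t * (\<Sum>e\<in>F. c e * (x 0 ^ (hd e - t) * y e))"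
    by (simp add: sum_distrib_left)
  also have "(\<Sum>e\<in>F. c e * (x 0 ^ (hd e - t) * y e))
      = (\<Sum>e\<in>F0. c e * (x 0 ^ (hd e - t) * y e)) + R"
    unfolding R_def using F0 Suc.prems(4) by (simp add: sum.subset_diff add.commute)
  also have "(\<Sum>e\<in>F0. c e * (x 0 ^ (hd e - t) * y e)) = Q"
    unfolding Q_def by (intro sum.cong) (auto simp: F0_def)
  finally have eq: "(\<Sum>e\<in>F. c e * (\<Prod>i<Suc m. x i ^ (e ! i))) = x 0 ^ t * (Q + R)" .
  have pr: "prime_set (P 0)" "prime_set (P 1)" and sub: "P 0 \<subseteq> P 1"
    and x0: "x 0 \<in> P 1" "x 0 \<notin> P 0"
    using Suc.prems(1)[of 0] Suc.prems(1)[of 1] Suc.prems(2)[of 0] Suc.prems(3)[of 0] by auto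
  \<comment> \<open>All lists in \<open>F0\<close> begin with \<open>t\<close>, so dropping the head
    merges no terms and the coefficients remain units.\<close>
  have inj: "inj_on tl F0"
  proof (rule inj_onI)
    fix e e' assume "e \<in> F0" "e' \<in> F0" "tl e = tl e'"
    moreover from this have "length e = Suc m" "length e' = Suc m" "hd e = hd e'"
      using Suc.prems(6) by (auto simp: F0_def)
    ultimately show "e = e'" by (cases e; cases e') auto
  qed
  have Q: "Q \<notin> P 1"
  proof -
    have "(\<Sum>e\<in>tl ` F0. c (t # e) * (\<Prod>i<m. x (Suc i) ^ (e ! i))) \<notin> P (Suc 0)"
    proof (rule Suc.IH[where P = "\<lambda>i. P (Suc i)" and x = "\<lambda>i. x (Suc i)" and c = "\<lambda>e. c (t # e)"])
      fix e assume "e \<in> tl ` F0"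
      then obtain e' where e': "e' \<in> F" "hd e' = t" "e = tl e'" by (auto simp: F0_def)
      moreover have "e' \<noteq> []" using Suc.prems(6)[OF e'(1)] by auto
      ultimately have "t # e \<in> F" by auto
      then show "c (t # e) dvd 1" by (rule Suc.prems(7))
      show "length e = m" using e' Suc.prems(6)[OF e'(1)] by simp
    qed (use Suc.prems F0 in auto)
    also have "(\<Sum>e\<in>tl ` F0. c (t # e) * (\<Prod>i<m. x (Suc i) ^ (e ! i))) = Q"
      unfolding sum.reindex[OF inj] Q_def y_def
    proof (rule sum.cong)
      fix e assume "e \<in> F0"
      then have "e \<noteq> []" "hd e = t" using Suc.prems(6)[of e] by (auto simp: F0_def)
      then show "((\<lambda>e. c (t # e) * (\<Prod>i<m. x (Suc i) ^ (e ! i))) \<circ> tl) e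
          = c e * (\<Prod>i<m. x (Suc i) ^ (tl e ! i))" by auto
    qed simp
    finally show ?thesis by simp
  qed
  have "R \<in> P 1"
    unfolding R_def
  proof (rule prime_set_sum[OF pr(2)])
    fix e assume "e \<in> F - F0"
    then have "hd e - t > 0" using t_le[of e] by (auto simp: F0_def)
    then have "x 0 ^ (hd e - t) \<in> P 1"
      using x0 pr by (cases "hd e - t") (auto simp: prime_set_mult_right)
    then show "c e * (x 0 ^ (hd e - t) * y e) \<in> P 1"
      using pr(2) by (simp add: prime_set_mult_iff)
  qed
  then have "Q + R \<notin> P 1"
    using Q prime_set_minus[OF pr(2), of "Q + R" R] by auto
  then show ?case
    unfolding eq using pr(1) sub x0 by (auto simp: prime_set_mult_iff prime_set_power)
qed


section \<open>Chains of primes in polynomial rings\<close>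

abbreviation "lookup \<equiv> Poly_Mapping.lookup"
abbreviation "keys \<equiv> Poly_Mapping.keys"

text \<open>
  Replaces the leading exponents for a monomial order, since \<open>'v\<close> carries no linear order.
\<close>

lemma exists_unique_sum_decomposition:
  fixes F G :: "('v::finite \<Rightarrow>\<^sub>0 nat) set"
  assumes "finite F" "F \<noteq> {}" "finite G" "G \<noteq> {}"
  obtains a b where "a \<in> F" "b \<in> G"
    "\<And>x y. x \<in> F \<Longrightarrow> y \<in> G \<Longrightarrow> x + y = a + b \<Longrightarrow> x = a \<and> y = b"
proof -
  \<comment> \<open>Generalised for induction over \<open>U\<close>, the coordinates in which the
    vectors may still differ. Each step keeps only the vectors that are maximal in one
    coordinate.\<close>
  have *: "\<exists>a\<in>F. \<exists>b\<in>G. \<forall>x\<in>F. \<forall>y\<in>G. x + y = a + b \<longrightarrow> x = a \<and> y = b"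
    if "finite U" "finite F" "F \<noteq> {}" "finite G" "G \<noteq> {}"
      "\<forall>x\<in>F. \<forall>y\<in>F. \<forall>v\<in>- U. lookup x v = lookup y v"
      "\<forall>x\<in>G. \<forall>y\<in>G. \<forall>v\<in>- U. lookup x v = lookup y v"
    for U :: "'v set" and F G :: "('v \<Rightarrow>\<^sub>0 nat) set"
    using that
  proof (induction U arbitrary: F G rule: finite_induct)
    case empty
    have F: "x = y" if "x \<in> F" "y \<in> F" for x y
      using empty.prems(5) that by (intro poly_mapping_eqI) blast
    have G: "x = y" if "x \<in> G" "y \<in> G" for x y
      using empty.prems(6) that by (intro poly_mapping_eqI) blast
    obtain a b where "a \<in> F" "b \<in> G" using empty.prems(2,4) by blast
    then show ?case using F G by blast
  next
    case (insert u U)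
    define s t where "s = Max ((\<lambda>x. lookup x u) ` F)" and "t = Max ((\<lambda>x. lookup x u) ` G)"
    define F' G' where "F' = {x \<in> F. lookup x u = s}" and "G' = {x \<in> G. lookup x u = t}"
    have le: "lookup x u \<le> s" if "x \<in> F" for x
      using that insert.prems(1) unfolding s_def by auto
    have le': "lookup x u \<le> t" if "x \<in> G" for x
      using that insert.prems(3) unfolding t_def by auto
    have "s \<in> (\<lambda>x. lookup x u) ` F" "t \<in> (\<lambda>x. lookup x u) ` G"
      using insert.prems(1-4) unfolding s_def t_def by (auto intro!: Max_in)
    then have ne: "F' \<noteq> {}" "G' \<noteq> {}" unfolding F'_def G'_def by auto
    have "\<exists>a\<in>F'. \<exists>b\<in>G'. \<forall>x\<in>F'. \<forall>y\<in>G'. x + y = a + b \<longrightarrow> x = a \<and> y = b"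
    proof (rule insert.IH)
      have "lookup x v = lookup y v" if "x \<in> F'" "y \<in> F'" "v \<in> - U" for x y v
        using insert.prems(5) that unfolding F'_def by (cases "v = u") (simp, blast)
      then show "\<forall>x\<in>F'. \<forall>y\<in>F'. \<forall>v\<in>- U. lookup x v = lookup y v" by blast
      have "lookup x v = lookup y v" if "x \<in> G'" "y \<in> G'" "v \<in> - U" for x y v
        using insert.prems(6) that unfolding G'_def by (cases "v = u") (simp, blast)
      then show "\<forall>x\<in>G'. \<forall>y\<in>G'. \<forall>v\<in>- U. lookup x v = lookup y v" by blast
    qed (use ne insert.prems(1,3) in \<open>auto simp: F'_def G'_def\<close>)
    then obtain a b where ab: "a \<in> F'" "b \<in> G'"
      "\<And>x y. x \<in> F' \<Longrightarrow> y \<in> G' \<Longrightarrow> x + y = a + b \<Longrightarrow> x = a \<and> y = b" by blast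
    \<comment> \<open>The sum \<open>s + t\<close> of the two maxima is attained in coordinate
      \<open>u\<close> only if both summands are maximal there.\<close>
    have "x = a \<and> y = b" if "x \<in> F" "y \<in> G" "x + y = a + b" for x y
    proof (rule ab(3))
      have "lookup x u + lookup y u = s + t"
        using arg_cong[OF that(3), of "\<lambda>z. lookup z u"] ab(1,2)
        by (simp add: lookup_add F'_def G'_def)
      then show "x \<in> F'" "y \<in> G'"
        using that le[of x] le'[of y] unfolding F'_def G'_def by auto
    qed fact
    then show ?case using ab(1,2) unfolding F'_def G'_def by auto
  qed
  have "\<exists>a\<in>F. \<exists>b\<in>G. \<forall>x\<in>F. \<forall>y\<in>G. x + y = a + b \<longrightarrow> x = a \<and> y = b"
    using assms by (intro *[of UNIV]) auto
  then show ?thesis using that by blast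
qed

text \<open>The ideal generated by the variables in \<open>C\<close>, described by its monomials so
  that membership can be read off from \<open>keys\<close>.\<close>

definition var_prime :: "'v::finite set \<Rightarrow> ('v, 'k::field) mpoly set" where
  "var_prime C = {p. \<forall>\<mu>\<in>keys p. \<exists>v\<in>C. lookup \<mu> v \<noteq> 0}"

lemma var_primeD: "p \<in> var_prime C \<Longrightarrow> (\<And>v. v \<in> C \<Longrightarrow> lookup \<mu> v = 0) \<Longrightarrow> lookup p \<mu> = 0"
  unfolding var_prime_def by (rule ccontr) (force dest!: bspec[where x = \<mu>] simp: in_keys_iff)

lemma var_prime_mono: "C \<subseteq> D \<Longrightarrow> var_prime C \<subseteq> var_prime D"
  unfolding var_prime_def by blast

lemma mvar_in_var_prime_iff: "mvar v \<in> var_prime C \<longleftrightarrow> v \<in> C"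
  unfolding var_prime_def mvar_def by (auto simp: lookup_single when_def)

lemma var_prime_strict_mono: "C \<subset> D \<Longrightarrow> (var_prime C :: ('v::finite, 'k::field) mpoly set) \<subset> var_prime D"
  using var_prime_mono[of C D] mvar_in_var_prime_iff by blast

text \<open>For primality, take two polynomials outside the ideal and their monomials free of
  \<open>C\<close>. Some product of two such monomials arises in only one way, so its coefficient in
  the product polynomial cannot cancel.\<close>

lemma prime_set_var_prime: "prime_set (var_prime C :: ('v::finite, 'k::field) mpoly set)"
  unfolding prime_set_def
proof (intro conjI allI ballI impI)
  show "0 \<in> var_prime C" "1 \<notin> (var_prime C :: ('v, 'k) mpoly set)"
    unfolding var_prime_def by (auto simp: keys_one)
  fix p q :: "('v, 'k) mpoly"
  show "p * q \<in> var_prime C" if "p \<in> var_prime C"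
    using that keys_mult[of p q] unfolding var_prime_def by (fastforce simp: lookup_add)
  show "p + q \<in> var_prime C" if "p \<in> var_prime C" "q \<in> var_prime C"
    using that keys_add[of p q] unfolding var_prime_def by blast
  show "p \<in> var_prime C \<or> q \<in> var_prime C" if pq: "p * q \<in> var_prime C"
  proof (rule ccontr)
    assume neg: "\<not> (p \<in> var_prime C \<or> q \<in> var_prime C)"
    define F where "F r = {\<mu> \<in> keys r. \<forall>v\<in>C. lookup \<mu> v = 0}" for r :: "('v, 'k) mpoly"
    have "F p \<noteq> {}" "F q \<noteq> {}" "finite (F p)" "finite (F q)"
      using neg unfolding F_def var_prime_def by auto
    then obtain a b where ab: "a \<in> F p" "b \<in> F q"
      and uniq: "\<And>x y. x \<in> F p \<Longrightarrow> y \<in> F q \<Longrightarrow> x + y = a + b \<Longrightarrow> x = a \<and> y = b"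
      using exists_unique_sum_decomposition[of "F p" "F q"] by metis
    \<comment> \<open>Since \<open>a + b\<close> vanishes on \<open>C\<close>, the summands of any
      decomposition do too, so uniqueness extends to all monomials of \<open>p\<close> and
      \<open>q\<close>.\<close>
    have uniq': "x = a \<and> y = b" if "x \<in> keys p" "y \<in> keys q" "a + b = x + y" for x y
    proof (rule uniq)
      have "lookup x v + lookup y v = 0" if "v \<in> C" for v
        using arg_cong[OF \<open>a + b = x + y\<close>, of "\<lambda>z. lookup z v"] ab that
        by (simp add: lookup_add F_def)
      then show "x \<in> F p" "y \<in> F q" using that unfolding F_def by auto
    qed (use that in simp)
    have "lookup p x * (\<Sum>y. (lookup q y when a + b = x + y)) = (lookup p a * lookup q b when x = a)" for x
    proof (cases "lookup p x = 0")
      case False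
      have "((lookup q y when a + b = x + y)) = ((lookup q b when x = a) when y = b)" for y
        using uniq'[of x y] False by (auto simp: when_def in_keys_iff)
      then have "lookup p x * (\<Sum>y. (lookup q y when a + b = x + y)) = lookup p x * (lookup q b when x = a)"
        by simp
      then show ?thesis by (cases "x = a") auto
    qed (auto simp: when_def)
    then have "lookup (p * q) (a + b) = lookup p a * lookup q b"
      unfolding lookup_mult by simp
    moreover have "lookup (p * q) (a + b) = 0"
      using pq ab by (rule_tac var_primeD[OF pq]) (auto simp: F_def lookup_add)
    ultimately show False using ab by (auto simp: F_def in_keys_iff)
  qed
qed

text \<open>Every monomial of a member is a multiple of some variable in \<open>C\<close>. Thus a
  prime may be replaced by the monomial prime of the variables it contains.\<close>

lemma var_prime_least:
  fixes P :: "('v::finite, 'k::field) mpoly set"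
  assumes P: "prime_set P" and C: "\<And>v. v \<in> C \<Longrightarrow> mvar v \<in> P"
  shows "var_prime C \<subseteq> P"
proof
  fix p :: "('v, 'k) mpoly" assume p: "p \<in> var_prime C"
  have "Poly_Mapping.single \<mu> (lookup p \<mu>) \<in> P" if \<mu>: "\<mu> \<in> keys p" for \<mu>
  proof -
    obtain v where v: "v \<in> C" "lookup \<mu> v \<noteq> 0"
      using p \<mu> unfolding var_prime_def by auto
    define \<nu> where "\<nu> = \<mu> - Poly_Mapping.single v 1"
    have "\<mu> = Poly_Mapping.single v 1 + \<nu>"
      using v(2) by (intro poly_mapping_eqI)
        (auto simp: \<nu>_def lookup_add lookup_minus lookup_single when_def)
    then have "Poly_Mapping.single \<mu> (lookup p \<mu>) = mvar v * Poly_Mapping.single \<nu> (lookup p \<mu>)"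
      unfolding mvar_def by (simp add: mult_single)
    then show ?thesis using C[OF v(1)] P by (simp add: prime_set_mult_right)
  qed
  moreover have "p = (\<Sum>\<mu>\<in>keys p. Poly_Mapping.single \<mu> (lookup p \<mu>))"
    by (intro poly_mapping_eqI)
      (auto simp: lookup_sum lookup_single when_def in_keys_iff cong: sum.cong)
  ultimately show "p \<in> P" using prime_set_sum[OF P] by metis
qed

section \<open>Bounding exponents and counting monomials\<close>

definition exponents_le :: "nat \<Rightarrow> ('v, 'k::zero) mpoly \<Rightarrow> bool" where
  "exponents_le n p \<longleftrightarrow> (\<forall>\<mu>\<in>keys p. \<forall>v. lookup \<mu> v \<le> n)"

lemma exponents_le_mono: "exponents_le m p \<Longrightarrow> m \<le> n \<Longrightarrow> exponents_le n p"
  unfolding exponents_le_def by (meson order_trans)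

lemma exponents_le_one: "exponents_le n 1"
  unfolding exponents_le_def by auto

lemma exponents_le_mult:
  "exponents_le m p \<Longrightarrow> exponents_le n q \<Longrightarrow> exponents_le (m + n) (p * q)"
  using keys_mult[of p q] unfolding exponents_le_def
  by (fastforce simp: lookup_add intro: add_mono)

lemma exponents_le_power: "exponents_le D p \<Longrightarrow> exponents_le (n * D) (p ^ n)"
  by (induction n) (auto simp: exponents_le_one exponents_le_mult)

lemma exponents_le_prod:
  "(\<And>i. i \<in> I \<Longrightarrow> exponents_le D (f i)) \<Longrightarrow> finite I \<Longrightarrow> exponents_le (card I * D) (prod f I)"
  by (induction I rule: infinite_finite_induct) (auto simp: exponents_le_one exponents_le_mult)

lemma exists_exponents_le:
  fixes f :: "'i \<Rightarrow> ('v::finite, 'k::zero) mpoly"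
  assumes "finite I"
  obtains D where "\<And>i. i \<in> I \<Longrightarrow> exponents_le D (f i)" "D > 0"
proof -
  have fin: "finite (\<Union>i\<in>I. \<Union>\<mu>\<in>keys (f i). range (lookup \<mu>))" (is "finite ?S")
    using assms by auto
  \<comment> \<open>\<open>Suc\<close> makes the bound positive even if all exponents are zero; the
    monomial count relies on this.\<close>
  show ?thesis
  proof (rule that[of "Suc (Max ?S)"])
    fix i assume "i \<in> I"
    show "exponents_le (Suc (Max ?S)) (f i)"
      unfolding exponents_le_def
    proof (intro ballI allI)
      fix \<mu> v assume "\<mu> \<in> keys (f i)"
      then have "lookup \<mu> v \<in> ?S" using \<open>i \<in> I\<close> by auto
      then show "lookup \<mu> v \<le> Suc (Max ?S)" using Max_ge[OF fin] le_SucI by blast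
    qed
  qed simp
qed

lemma lookup_single_zero_mult:
  "lookup (Poly_Mapping.single 0 c * p) \<mu> = c * lookup p \<mu>" for p :: "('v, 'k::field) mpoly"
proof -
  have "lookup (Poly_Mapping.map ((*) c) p) \<mu> = c * lookup p \<mu>"
    by transfer (simp add: when_def)
  then show ?thesis unfolding mult_map_scale_conv_mult .
qed

text \<open>Bounding each exponent separately, rather than the degree, makes \<open>J\<close> embed
  into a box: its members are determined by their values on \<open>- C\<close>.\<close>

lemma card_exponents_le:
  fixes C :: "'v::finite set" and n :: nat
  defines "J \<equiv> {\<mu> :: 'v \<Rightarrow>\<^sub>0 nat. (\<forall>v\<in>C. lookup \<mu> v = 0) \<and> (\<forall>v. lookup \<mu> v \<le> n)}"
  shows "finite J" "card J \<le> Suc n ^ card (- C)"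
proof -
  have inj: "inj_on (\<lambda>\<mu>. restrict (lookup \<mu>) (- C)) J"
  proof (intro inj_onI poly_mapping_eqI)
    fix x y v assume "x \<in> J" "y \<in> J" "restrict (lookup x) (- C) = restrict (lookup y) (- C)"
    then show "lookup x v = lookup y v"
      by (cases "v \<in> C") (auto simp: J_def dest: fun_cong[where x = v])
  qed
  have sub: "(\<lambda>\<mu>. restrict (lookup \<mu>) (- C)) ` J \<subseteq> (- C) \<rightarrow>\<^sub>E {..n}"
    by (auto simp: J_def)
  have fin: "finite ((- C) \<rightarrow>\<^sub>E {..n})" by (intro finite_PiE) auto
  show "finite J" by (rule inj_on_finite[OF inj sub fin])
  have "card J \<le> card ((- C) \<rightarrow>\<^sub>E {..n})" by (rule card_inj_on_le[OF inj sub fin])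
  then show "card J \<le> Suc n ^ card (- C)" by (simp add: card_PiE)
qed

text \<open>
  If \<open>m\<close> exceeds the number \<open>N\<close> of variables outside \<open>C\<close>, choose \<open>x i\<close> in \<open>P (Suc i) - P i\<close>. The
  \<open>(d + 1)^m\<close> products of powers of the \<open>x i\<close> with exponents at most \<open>d\<close> involve only \<open>O(d^N)\<close>
  monomials in the variables outside \<open>C\<close>, so for large \<open>d\<close> they are linearly dependent modulo
  \<open>var_prime C\<close>.
\<close>

lemma prime_chain_length_le:
  fixes P :: "nat \<Rightarrow> ('v::finite, 'k::field) mpoly set"
  assumes prime: "\<And>i. i \<le> m \<Longrightarrow> prime_set (P i)"
    and strict: "\<And>i. i < m \<Longrightarrow> P i \<subset> P (Suc i)"
    and C: "var_prime C \<subseteq> P 0"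
  shows "m \<le> card (- C)"
proof (rule ccontr)
  assume neg: "\<not> ?thesis"
  define N where "N = card (- C)"
  have N: "N < m" using neg unfolding N_def by simp
  have "\<forall>i. \<exists>y. i < m \<longrightarrow> y \<in> P (Suc i) - P i" using strict by blast
  then obtain x where x: "\<And>i. i < m \<Longrightarrow> x i \<in> P (Suc i) - P i" by metis
  obtain D where D: "\<And>i. i \<in> {..<m} \<Longrightarrow> exponents_le D (x i)" "D > 0"
    using exists_exponents_le[of "{..<m}" x] by blast
  \<comment> \<open>Chosen so that \<open>(m * D * Suc d) ^ N\<close> equals
    \<open>d * Suc d ^ N\<close>, which is below \<open>Suc d ^ Suc N\<close>. The number
    \<open>b\<close> bounds the exponents in all products \<open>y e\<close>.\<close>
  define d where "d = (m * D) ^ N"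
  define b where "b = m * (d * D)"
  define I where "I = {e. set e \<subseteq> {..d} \<and> length e = m}"
  define J :: "('v \<Rightarrow>\<^sub>0 nat) set"
    where "J = {\<mu>. (\<forall>v\<in>C. lookup \<mu> v = 0) \<and> (\<forall>v. lookup \<mu> v \<le> b)}"
  define y where "y e = (\<Prod>i<m. x i ^ (e ! i))" for e
  have "Suc b \<le> m * D * Suc d" using N D(2) unfolding b_def by (simp add: algebra_simps Suc_le_eq)
  then have "Suc b ^ N \<le> (m * D * Suc d) ^ N" by (rule power_mono) simp
  also have "\<dots> = d * Suc d ^ N" unfolding d_def by (simp only: power_mult_distrib)
  also have "\<dots> < Suc d ^ Suc N" by simp
  also have "\<dots> \<le> Suc d ^ m" using N by (intro power_increasing) auto
  finally have "card J < card I"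
    using card_exponents_le(2)[of C b] unfolding I_def J_def N_def
    by (simp add: card_lists_length_eq)
  moreover have "finite J" "finite I"
    using card_exponents_le(1)[of C b] unfolding I_def J_def by (auto simp: finite_lists_length_eq)
  ultimately obtain c where c: "\<exists>e\<in>I. c e \<noteq> 0"
    and c0: "\<And>\<mu>. \<mu> \<in> J \<Longrightarrow> (\<Sum>e\<in>I. lookup (y e) \<mu> * c e) = 0"
    using homogeneous_system_nontrivial_solution[of J I "\<lambda>\<mu> e. lookup (y e) \<mu>"] by blast
  have y_le: "exponents_le b (y e)" if "e \<in> I" for e
  proof -
    have "exponents_le (d * D) (x i ^ (e ! i))" if "i \<in> {..<m}" for i
    proof (rule exponents_le_mono[OF exponents_le_power[OF D(1)[OF that]]])
      have "e ! i \<in> set e" using that \<open>e \<in> I\<close> unfolding I_def by auto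
      then show "e ! i * D \<le> d * D" using \<open>e \<in> I\<close> unfolding I_def by auto
    qed
    from exponents_le_prod[of "{..<m}", OF this] show ?thesis unfolding y_def b_def by simp
  qed
  \<comment> \<open>With the zero coefficients dropped, all remaining ones are units.\<close>
  define F where "F = {e \<in> I. c e \<noteq> 0}"
  have "(\<Sum>e\<in>F. Poly_Mapping.single 0 (c e) * y e) \<notin> P 0"
    unfolding y_def
  proof (rule prime_chain_no_relation)
    fix e assume "e \<in> F"
    then have "Poly_Mapping.single 0 (c e) * Poly_Mapping.single 0 (inverse (c e)) = (1 :: ('v, 'k) mpoly)"
      by (simp add: F_def mult_single)
    then show "Poly_Mapping.single 0 (c e) dvd (1 :: ('v, 'k) mpoly)" by (metis dvd_triv_left)
    show "length e = m" using \<open>e \<in> F\<close> by (simp add: F_def I_def)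
  next
    show "finite F" "F \<noteq> {}" using \<open>finite I\<close> c by (auto simp: F_def)
  qed (use prime strict x in auto)
  \<comment> \<open>A monomial free of \<open>C\<close> has coefficient zero: within the bound
    \<open>b\<close> by the choice of \<open>c\<close>, beyond it because no \<open>y e\<close>
    contains it.\<close>
  moreover have "(\<Sum>e\<in>F. Poly_Mapping.single 0 (c e) * y e) \<in> var_prime C"
    unfolding var_prime_def
  proof (intro CollectI ballI, rule ccontr)
    fix \<mu> assume \<mu>: "\<mu> \<in> keys (\<Sum>e\<in>F. Poly_Mapping.single 0 (c e) * y e)"
      and off: "\<not> (\<exists>v\<in>C. lookup \<mu> v \<noteq> 0)"
    have eq: "lookup (\<Sum>e\<in>F. Poly_Mapping.single 0 (c e) * y e) \<mu> = (\<Sum>e\<in>I. lookup (y e) \<mu> * c e)"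
      unfolding lookup_sum F_def using \<open>finite I\<close>
      by (intro sum.mono_neutral_cong_left) (auto simp: lookup_single_zero_mult)
    have "\<mu> \<notin> J" using \<mu> c0 eq by (auto simp: in_keys_iff)
    then obtain v where v: "\<not> lookup \<mu> v \<le> b"
      using off unfolding J_def by auto
    have "lookup (y e) \<mu> = 0" if "e \<in> I" for e
      using y_le[OF that] v unfolding exponents_le_def by (meson in_keys_iff)
    then show False using \<mu> eq by (auto simp: in_keys_iff)
  qed
  ultimately show False using C by blast
qed


section \<open>Prime chains in quotients and Krull dimension\<close>

lemma prime_set_if_primeideal:
  fixes P :: "'a::comm_ring_1 set"
  assumes "primeideal P ring_of_type_algebra"
  shows "prime_set P"
proof -
  interpret primeideal P "ring_of_type_algebra :: 'a ring" by fact
  show ?thesis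
    using additive_subgroup.zero_closed[OF additive_subgroup_axioms]
      additive_subgroup.a_closed[OF additive_subgroup_axioms] I_r_closed I_prime I_notcarr one_imp_carrier
    unfolding prime_set_def by (auto simp: ring_of_type_algebra_def)
qed

lemma primeideal_iff_prime_set:
  fixes P :: "'a::comm_ring_1 set"
  shows "primeideal P ring_of_type_algebra \<longleftrightarrow> prime_set P"
proof
  assume P: "prime_set P"
  interpret R: cring "ring_of_type_algebra :: 'a ring" by (rule cring_from_type_algebra)
  have minus: "\<ominus>\<^bsub>ring_of_type_algebra\<^esub> x = - x" for x :: 'a
    by (rule R.minus_equality) (auto simp: ring_of_type_algebra_def)
  have "ideal P (ring_of_type_algebra :: 'a ring)"
  proof (rule idealI)
    show "subgroup P (add_monoid ring_of_type_algebra)"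
    proof (rule R.add.subgroupI)
      show "P \<noteq> {}" using prime_set_zero[OF P] by blast
      show "\<ominus>\<^bsub>ring_of_type_algebra\<^esub> x \<in> P" if "x \<in> P" for x
        using prime_set_mult_right[OF P that, of "- 1"] by (simp add: minus)
    qed (use prime_set_add[OF P] in \<open>auto simp: ring_of_type_algebra_def\<close>)
  qed (use R.ring_axioms prime_set_mult_right[OF P] prime_set_mult_left[OF P] in
      \<open>auto simp: ring_of_type_algebra_def\<close>)
  then show "primeideal P ring_of_type_algebra"
    using R.cring_axioms prime_set_one[OF P] prime_set_mult_iff[OF P]
    by (intro primeidealI) (auto simp: ring_of_type_algebra_def)
qed (rule prime_set_if_primeideal)

text \<open>As \<open>I \<subseteq> J\<close>, the union of the cosets is \<open>J\<close> again, so
  membership in the image can be tested on representatives.\<close>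

lemma (in cring) primeideal_Quot_image:
  assumes I: "ideal I R" and J: "primeideal J R" "I \<subseteq> J"
  shows "primeideal ((+>) I ` J) (R Quot I)"
proof (rule primeidealI)
  interpret J: primeideal J R by fact
  interpret I: ideal I R by fact
  have ideal: "ideal ((+>) I ` J) (R Quot I)"
    using quot_ideal_correspondence[OF I] J J.is_ideal unfolding bij_betw_def by blast
  then show "ideal ((+>) I ` J) (R Quot I)" .
  show "cring (R Quot I)" by (rule I.quotient_is_cring[OF is_cring])
  have sub: "(+>) I ` J \<subseteq> carrier (R Quot I)"
    using ideal additive_subgroup.a_subset ideal.axioms(1) by blast
  have U: "\<Union> ((+>) I ` J) = J" using ideal_incl_iff[OF I J.is_ideal] J(2) by auto
  have mem: "I +> a \<in> (+>) I ` J \<longleftrightarrow> a \<in> J" if "a \<in> carrier R" for a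
    using canonical_proj_vimage_mem_iff[OF I sub that] U by simp
  have carr: "carrier (R Quot I) = (+>) I ` carrier R"
    unfolding FactRing_def A_RCOSETS_def' by auto
  show "carrier (R Quot I) \<noteq> (+>) I ` J"
  proof
    assume eq: "carrier (R Quot I) = (+>) I ` J"
    have "carrier R \<subseteq> J"
    proof
      fix x assume x: "x \<in> carrier R"
      then have "I +> x \<in> (+>) I ` J" unfolding eq[symmetric] carr by (rule imageI)
      then show "x \<in> J" using mem[OF x] by simp
    qed
    then show False using J.I_notcarr J.a_subset by auto
  qed
  fix a b assume ab: "a \<in> carrier (R Quot I)" "b \<in> carrier (R Quot I)"
    "a \<otimes>\<^bsub>R Quot I\<^esub> b \<in> (+>) I ` J"
  then obtain x y where xy: "x \<in> carrier R" "a = I +> x" "y \<in> carrier R" "b = I +> y"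
    unfolding carr by blast
  have "I +> (x \<otimes> y) \<in> (+>) I ` J"
    using ab(3) xy by (simp add: FactRing_def I.rcoset_mult_add)
  then have "x \<in> J \<or> y \<in> J" using mem xy J.I_prime by auto
  then show "a \<in> (+>) I ` J \<or> b \<in> (+>) I ` J" using xy by blast
qed

lemma (in cring) primeideal_Union_Quot:
  assumes I: "ideal I R" and J: "primeideal J (R Quot I)"
  shows "primeideal (\<Union> J) R" "I \<subseteq> \<Union> J"
proof -
  interpret J: primeideal J "R Quot I" by fact
  interpret I: ideal I R by fact
  have carr: "carrier (R Quot I) = (+>) I ` carrier R"
    unfolding FactRing_def A_RCOSETS_def' by auto
  have mem: "a \<in> \<Union> J \<longleftrightarrow> I +> a \<in> J" if "a \<in> carrier R" for a
    using canonical_proj_vimage_mem_iff[OF I J.a_subset that] .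
  show "I \<subseteq> \<Union> J"
    using additive_subgroup.zero_closed[OF J.additive_subgroup_axioms] by (auto simp: FactRing_def)
  show "primeideal (\<Union> J) R"
  proof (rule primeidealI)
    show "ideal (\<Union> J) R" by (rule quot_ideal_imp_ring_ideal[OF I J.is_ideal])
    show "carrier R \<noteq> \<Union> J"
    proof
      assume eq: "carrier R = \<Union> J"
      have "carrier (R Quot I) \<subseteq> J" unfolding carr using mem eq by auto
      then show False using J.I_notcarr J.a_subset by auto
    qed
    fix a b assume ab: "a \<in> carrier R" "b \<in> carrier R" "a \<otimes> b \<in> \<Union> J"
    then have "(I +> a) \<otimes>\<^bsub>R Quot I\<^esub> (I +> b) \<in> J"
      using mem by (simp add: FactRing_def I.rcoset_mult_add)
    then show "a \<in> \<Union> J \<or> b \<in> \<Union> J"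
      using J.I_prime[of "I +> a" "I +> b"] ab mem carr by auto
  qed (rule is_cring)
qed

text \<open>Coset images and unions are mutually inverse between ideals above \<open>I\<close> and
  ideals of the quotient, so they carry chains of primes over in both directions.\<close>

lemma (in cring) krull_dim_Quot:
  assumes I: "ideal I R"
  shows "krull_dim (R Quot I) = Sup {ereal (real n) | n. \<exists>P. prime_chain R n P \<and> I \<subseteq> P 0}"
proof -
  have "(\<exists>P. prime_chain (R Quot I) n P) \<longleftrightarrow> (\<exists>P. prime_chain R n P \<and> I \<subseteq> P 0)" for n
  proof
    assume "\<exists>P. prime_chain (R Quot I) n P"
    then obtain P where P: "\<And>i. i \<le> n \<Longrightarrow> primeideal (P i) (R Quot I)" "\<And>i. i < n \<Longrightarrow> P i \<subset> P (Suc i)"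
      unfolding prime_chain_def by blast
    \<comment> \<open>Recovering \<open>P i\<close> from its union keeps the inclusions
      strict.\<close>
    have img: "(+>) I ` \<Union> (P i) = P i" if "i \<le> n" for i
    proof -
      have "P i \<in> {J. ideal J (R Quot I)}"
        using P(1)[OF that] by (simp add: primeideal.axioms(1))
      then have "P i \<in> (\<lambda>J. (+>) I ` J) ` {J. ideal J R \<and> I \<subseteq> J}"
        using quot_ideal_correspondence[OF I] unfolding bij_betw_def by simp
      then obtain J where "ideal J R" "I \<subseteq> J" "P i = (+>) I ` J" by blast
      moreover from this have "\<Union> (P i) = J" using ideal_incl_iff[OF I] by auto
      ultimately show ?thesis by simp
    qed
    have "prime_chain R n (\<lambda>i. \<Union> (P i))"
      unfolding prime_chain_def
    proof (intro conjI allI impI)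
      fix i assume "i < n"
      then show "\<Union> (P i) \<subset> \<Union> (P (Suc i))"
        using P(2)[of i] img[of i] img[of "Suc i"] by (metis Suc_leI Union_mono less_imp_le psubset_eq)
    qed (rule primeideal_Union_Quot[OF I P(1)])
    then show "\<exists>P. prime_chain R n P \<and> I \<subseteq> P 0"
      using primeideal_Union_Quot(2)[OF I P(1)] by blast
  next
    assume "\<exists>P. prime_chain R n P \<and> I \<subseteq> P 0"
    then obtain P where P: "\<And>i. i \<le> n \<Longrightarrow> primeideal (P i) R" "\<And>i. i < n \<Longrightarrow> P i \<subset> P (Suc i)"
      and I0: "I \<subseteq> P 0"
      unfolding prime_chain_def by blast
    have sub: "I \<subseteq> P i" if "i \<le> n" for i
      using that
    proof (induction i)
      case (Suc i)
      then show ?case using P(2)[of i] by auto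
    qed (rule I0)
    have U: "\<Union> ((+>) I ` P i) = P i" if "i \<le> n" for i
      using ideal_incl_iff[OF I, of "P i"] sub[OF that] P(1)[OF that] by (auto simp: primeideal.axioms(1))
    have "prime_chain (R Quot I) n (\<lambda>i. (+>) I ` P i)"
      unfolding prime_chain_def
    proof (intro conjI allI impI)
      fix i assume i: "i < n"
      then have "P i \<noteq> P (Suc i)" "\<Union> ((+>) I ` P i) = P i"
        "\<Union> ((+>) I ` P (Suc i)) = P (Suc i)"
        using U[of i] U[of "Suc i"] P(2)[of i] by auto
      then have "(+>) I ` P i \<noteq> (+>) I ` P (Suc i)" by metis
      moreover have "(+>) I ` P i \<subseteq> (+>) I ` P (Suc i)" using P(2)[OF i] by (intro image_mono) auto
      ultimately show "(+>) I ` P i \<subset> (+>) I ` P (Suc i)" by (rule psubsetI[rotated])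
    next
      fix i assume "i \<le> n"
      then show "primeideal ((+>) I ` P i) (R Quot I)"
        by (intro primeideal_Quot_image I P(1) sub)
    qed
    then show "\<exists>P. prime_chain (R Quot I) n P" by blast
  qed
  then show ?thesis unfolding krull_dim_def by simp
qed

section \<open>Monomial prime chains and heights\<close>

lemma exists_prime_chain_var_prime:
  fixes C D :: "'v::finite set"
  assumes "C \<subseteq> D"
  obtains P where "prime_chain (mpoly_ring TYPE('k::field)) (card D - card C) P"
    "P 0 = var_prime C" "P (card D - card C) = var_prime D"
proof -
  have n: "card D - card C = card (D - C)"
    using assms by (simp add: card_Diff_subset)
  obtain ws where ws: "set ws = D - C" "distinct ws"
    using finite_distinct_list[of "D - C"] by auto
  then have len: "length ws = card (D - C)" using distinct_card by fastforce
  \<comment> \<open>The variables in \<open>D - C\<close> are adjoined one at a time, in the order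
    of \<open>ws\<close>.\<close>
  show ?thesis
  proof (rule that[of "\<lambda>i. var_prime (C \<union> set (take i ws))"])
    show "prime_chain (mpoly_ring TYPE('k)) (card D - card C) (\<lambda>i. var_prime (C \<union> set (take i ws)))"
      unfolding prime_chain_def n len[symmetric]
    proof (intro conjI allI impI)
      fix i assume i: "i < length ws"
      have "ws ! i \<notin> C" using ws(1) i nth_mem by blast
      moreover have "ws ! i \<notin> set (take i ws)"
        using ws(2) i by (auto simp: in_set_conv_nth nth_eq_iff_index_eq)
      moreover have "set (take (Suc i) ws) = insert (ws ! i) (set (take i ws))"
        using i by (simp add: take_Suc_conv_app_nth)
      ultimately show "var_prime (C \<union> set (take i ws)) \<subset> var_prime (C \<union> set (take (Suc i) ws))"
        by (intro var_prime_strict_mono) auto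
    qed (simp add: primeideal_iff_prime_set prime_set_var_prime)
  qed (use assms ws n len in \<open>auto simp: Un_absorb1\<close>)
qed

lemma prime_chain_append:
  assumes P: "prime_chain R m P" and Q: "prime_chain R n Q" and eq: "P m = Q 0"
  shows "prime_chain R (m + n) (\<lambda>i. if i \<le> m then P i else Q (i - m))"
  unfolding prime_chain_def
proof (intro conjI allI impI)
  fix i assume "i \<le> m + n"
  then show "primeideal (if i \<le> m then P i else Q (i - m)) R"
    using P Q unfolding prime_chain_def by auto
next
  fix i assume i: "i < m + n"
  consider "i < m" | "i = m" | "i > m" by linarith
  then show "(if i \<le> m then P i else Q (i - m)) \<subset> (if Suc i \<le> m then P (Suc i) else Q (Suc i - m))"
  proof cases
    case 3
    then have "Q (i - m) \<subset> Q (Suc (i - m))" using Q i unfolding prime_chain_def by simp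
    then show ?thesis using 3 by (simp add: Suc_diff_le)
  qed (use P Q i eq in \<open>auto simp: prime_chain_def\<close>)
qed

lemma prime_chain_mpoly_length_le:
  fixes C :: "'v::finite set"
  assumes "prime_chain (mpoly_ring TYPE('k::field)) m P" "\<And>v. v \<in> C \<Longrightarrow> mvar v \<in> P 0"
  shows "m \<le> card (- C)"
proof (rule prime_chain_length_le)
  show "prime_set (P i)" if "i \<le> m" for i
    using assms(1) that unfolding prime_chain_def primeideal_iff_prime_set by blast
  then show "var_prime C \<subseteq> P 0" using assms(2) by (intro var_prime_least) auto
qed (use assms(1) in \<open>auto simp: prime_chain_def\<close>)

text \<open>A chain ending at \<open>var_prime C\<close> extends by \<open>CARD('v) - card C\<close>
  steps to the ideal of all variables, and the whole chain has length at most
  \<open>CARD('v)\<close>.\<close>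

lemma prime_height_var_prime_le:
  fixes C :: "'v::finite set"
  shows "prime_height (mpoly_ring TYPE('k::field)) (var_prime C) \<le> card C"
  unfolding prime_height_def
proof (rule Sup_least, clarify)
  fix m and P :: "nat \<Rightarrow> ('v, 'k) mpoly set"
  assume P: "prime_chain (mpoly_ring TYPE('k)) m P" "P m = var_prime C"
  obtain Q where Q: "prime_chain (mpoly_ring TYPE('k)) (card (UNIV :: 'v set) - card C) Q" "Q 0 = var_prime C"
    by (rule exists_prime_chain_var_prime[of C UNIV]) auto
  have "m + (CARD('v) - card C) \<le> card (- {} :: 'v set)"
    by (rule prime_chain_mpoly_length_le[OF prime_chain_append[OF P(1) Q(1)]]) (use P Q in auto)
  moreover have "card C \<le> CARD('v)" by (rule card_mono) auto
  ultimately show "ereal (real m) \<le> ereal (real (card C))" by simp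
qed

lemma prime_height_ge:
  fixes C :: "'v::finite set"
  assumes Q: "primeideal Q (mpoly_ring TYPE('k::field))" "var_prime C \<subseteq> Q"
  shows "card C \<le> prime_height (mpoly_ring TYPE('k)) Q"
proof -
  obtain P where P: "prime_chain (mpoly_ring TYPE('k)) (card C - card ({} :: 'v set)) P"
    "P (card C - card ({} :: 'v set)) = var_prime C"
    by (rule exists_prime_chain_var_prime[of "{}" C]) auto
  \<comment> \<open>Replacing the top of the monomial chain by the possibly larger \<open>Q\<close>
    keeps its length.\<close>
  have "prime_chain (mpoly_ring TYPE('k)) (card C) (P(card C := Q))"
    unfolding prime_chain_def
  proof (intro conjI allI impI)
    fix i assume i: "i < card C"
    then have "P i \<subset> P (Suc i)" using P(1) unfolding prime_chain_def by simp
    moreover have "P (Suc i) \<subseteq> Q" if "Suc i = card C" using P(2) Q(2) that by simp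
    ultimately show "(P(card C := Q)) i \<subset> (P(card C := Q)) (Suc i)"
      using i by (cases "Suc i = card C") auto
  qed (use P Q in \<open>auto simp: prime_chain_def\<close>)
  then show ?thesis
    unfolding prime_height_def by (intro Sup_upper) (auto intro!: exI[of _ "P(card C := Q)"])
qed

section \<open>Primes over edge ideals and matching powers\<close>

lemma edge_monomial_in_iff: "prime_set P \<Longrightarrow> edge_monomial e \<in> P \<longleftrightarrow> (\<exists>v\<in>e. mvar v \<in> P)"
  unfolding edge_monomial_def by (simp add: prime_set_prod_iff)

lemma matching_monomial_in_iff:
  "prime_set P \<Longrightarrow> (\<Prod>e\<in>M. edge_monomial e) \<in> P \<longleftrightarrow> (\<exists>v\<in>\<Union>M. mvar v \<in> P)"
  by (simp add: prime_set_prod_iff edge_monomial_in_iff)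

lemma Idl_subset_prime_set_iff:
  fixes P :: "'a::comm_ring_1 set"
  assumes "prime_set P"
  shows "Idl\<^bsub>ring_of_type_algebra\<^esub> S \<subseteq> P \<longleftrightarrow> S \<subseteq> P"
proof (rule ring.Idl_subset_ideal)
  show "ring (ring_of_type_algebra :: 'a ring)" ..
  show "ideal P ring_of_type_algebra"
    using assms by (simp add: primeideal_iff_prime_set[symmetric] primeideal.axioms(1))
qed (simp add: ring_of_type_algebra_def)

lemma edge_ideal_subset_iff:
  "prime_set P \<Longrightarrow> edge_ideal K E \<subseteq> P \<longleftrightarrow> vertex_cover E {v. mvar v \<in> P}"
  unfolding edge_ideal_def vertex_cover_def
  by (auto simp: Idl_subset_prime_set_iff edge_monomial_in_iff image_subset_iff)

text \<open>By primality a product of variables avoids \<open>P\<close> iff each factor does, so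
  only the set of variables outside \<open>P\<close> matters.\<close>

lemma matching_power_subset_iff:
  "prime_set P \<Longrightarrow> matching_power K E k \<subseteq> P \<longleftrightarrow>
    (\<forall>M. matching E M \<and> card M = k \<longrightarrow> \<not> \<Union>M \<subseteq> {v. mvar v \<notin> P})"
proof -
  assume P: "prime_set P"
  have "matching_power K E k \<subseteq> P \<longleftrightarrow> (\<forall>M. matching E M \<and> card M = k \<longrightarrow> (\<Prod>e\<in>M. edge_monomial e) \<in> P)"
    unfolding matching_power_def Idl_subset_prime_set_iff[OF P] by blast
  then show ?thesis unfolding matching_monomial_in_iff[OF P] by blast
qed

text \<open>The prime \<open>var_prime C\<close> gives the upper bound. Conversely, every prime over
  the edge ideal contains the variables of some minimal vertex cover, which has the size of
  \<open>C\<close> by unmixedness.\<close>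

lemma ideal_height_edge_ideal:
  fixes E :: "'v::finite set set"
  assumes unm: "unmixed E" and C: "minimal_vertex_cover E C"
  shows "ideal_height (mpoly_ring TYPE('k::field)) (edge_ideal TYPE('k) E) = card C"
proof (rule antisym)
  have "edge_ideal TYPE('k) E \<subseteq> var_prime C"
    using C by (subst edge_ideal_subset_iff)
      (auto simp: prime_set_var_prime mvar_in_var_prime_iff minimal_vertex_cover_def)
  then have "ideal_height (mpoly_ring TYPE('k)) (edge_ideal TYPE('k) E)
      \<le> prime_height (mpoly_ring TYPE('k)) (var_prime C)"
    unfolding ideal_height_def
    by (intro Inf_lower) (auto simp: primeideal_iff_prime_set prime_set_var_prime)
  also have "\<dots> \<le> card C" by (rule prime_height_var_prime_le)
  finally show "ideal_height (mpoly_ring TYPE('k)) (edge_ideal TYPE('k) E) \<le> card C" .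
  show "card C \<le> ideal_height (mpoly_ring TYPE('k)) (edge_ideal TYPE('k) E)"
    unfolding ideal_height_def
  proof (rule Inf_greatest, clarify)
    fix Q :: "('v, 'k) mpoly set"
    assume Q: "primeideal Q ring_of_type_algebra" "edge_ideal TYPE('k) E \<subseteq> Q"
    then have pQ: "prime_set Q" by (simp add: primeideal_iff_prime_set)
    then have "vertex_cover E {v. (mvar v :: ('v, 'k) mpoly) \<in> Q}"
      using Q by (simp add: edge_ideal_subset_iff)
    then obtain D where D: "D \<subseteq> {v. (mvar v :: ('v, 'k) mpoly) \<in> Q}" "minimal_vertex_cover E D"
      by (rule minimal_vertex_cover_within)
    have "card D = card C" using unm C D unfolding unmixed_def by blast
    moreover have "card D \<le> prime_height (mpoly_ring TYPE('k)) Q"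
      using D pQ by (intro prime_height_ge Q var_prime_least) auto
    ultimately show "ereal (card C) \<le> prime_height ring_of_type_algebra Q" by simp
  qed
qed

theorem proposition2p7:
  fixes E :: "'v::finite set set"
  assumes "simple_graph E"
    and "\<not> (\<exists>v. isolated_vertex E v)"
    and "very_well_covered TYPE('k::field) E"
    and "cohen_macaulay_graph TYPE('k) E"
  shows "\<forall>k. 1 \<le> k \<and> k \<le> matching_number E \<longrightarrow>
    krull_dim (mpoly_ring TYPE('k) Quot matching_power TYPE('k) E k) =
      ereal (real CARD('v) / 2 + real k - 1)"
proof (intro allI impI)
  fix k assume k: "1 \<le> k \<and> k \<le> matching_number E"
  note simple = assms(1)
  have no_iso: "\<not> isolated_vertex E v" for v using assms(2) by blast
  have unm: "unmixed E" using assms(3) unfolding very_well_covered_def by blast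
  have "vertex_cover E UNIV"
    using simple unfolding vertex_cover_def simple_graph_def by fastforce
  then obtain C where C: "minimal_vertex_cover E C"
    by (rule minimal_vertex_cover_within)
  then have cover: "vertex_cover E C" unfolding minimal_vertex_cover_def by blast
  \<comment> \<open>The height hypothesis is turned into a purely combinatorial equation.\<close>
  have card_C: "2 * card C = CARD('v)"
    using assms(3) ideal_height_edge_ideal[OF unm C, where ?'k = 'k]
    unfolding very_well_covered_def by auto
  let ?R = "mpoly_ring TYPE('k) :: ('v, 'k) mpoly ring"
  let ?I = "matching_power TYPE('k) E k"
  have I: "ideal ?I ?R"
    unfolding matching_power_def
    by (rule ring.genideal_ideal[OF ring_from_type_algebra]) (simp add: ring_of_type_algebra_def)
  have "krull_dim (?R Quot ?I) = Sup {ereal (real n) | n. \<exists>P. prime_chain ?R n P \<and> ?I \<subseteq> P 0}"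
    using cring.krull_dim_Quot[OF cring_from_type_algebra I] .
  also have "\<dots> = ereal (real (card C + k - 1))"
  proof (rule antisym)
    show "Sup {ereal (real n) | n. \<exists>P. prime_chain ?R n P \<and> ?I \<subseteq> P 0} \<le> ereal (real (card C + k - 1))"
    proof (rule Sup_least, clarify)
      fix n P assume P: "prime_chain ?R n P" "?I \<subseteq> P 0"
      define W where "W = {v. (mvar v :: ('v, 'k) mpoly) \<notin> P 0}"
      have "prime_set (P 0)"
        using P(1) unfolding prime_chain_def primeideal_iff_prime_set by blast
      then have no_matching: "\<not> \<Union>M \<subseteq> W" if "matching E M" "card M = k" for M
        using P(2) that unfolding W_def by (simp add: matching_power_subset_iff)
      have "card W < card C + k"
      proof (rule ccontr)
        assume "\<not> card W < card C + k"
        then have "card C + k \<le> card W" by simp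
        from well_covered_matching_within[OF simple no_iso unm cover card_C this]
        show False using no_matching by metis
      qed
      \<comment> \<open>The chain bound is applied to \<open>- W\<close>, the set of variables
        contained in \<open>P 0\<close>.\<close>
      moreover have "n \<le> card (- (- W))"
        by (rule prime_chain_mpoly_length_le[OF P(1)]) (simp add: W_def)
      ultimately show "ereal (real n) \<le> ereal (real (card C + k - 1))" by simp
    qed
  next
    obtain W where W: "card W = card (- C) + k - 1"
      "\<And>M. matching E M \<Longrightarrow> card M = k \<Longrightarrow> \<not> \<Union>M \<subseteq> W"
      using no_matching_within_enlarged_independent_set[OF cover] k by blast
    have "card (- C) = card C" using card_C by (simp add: card_Compl)
    moreover have "card W \<le> CARD('v)" by (rule card_mono) auto
    ultimately have card_W: "CARD('v) - card (- W) = card C + k - 1"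
      using W(1) by (simp add: card_Compl)
    \<comment> \<open>The chain rises from the variables outside \<open>W\<close> to all variables,
      so its length is \<open>card W\<close>.\<close>
    obtain P where P: "prime_chain ?R (card (UNIV :: 'v set) - card (- W)) P" "P 0 = var_prime (- W)"
      by (rule exists_prime_chain_var_prime[of "- W" UNIV]) auto
    have "?I \<subseteq> P 0"
      using W(2) by (simp add: P(2) matching_power_subset_iff prime_set_var_prime mvar_in_var_prime_iff)
    then show "ereal (real (card C + k - 1)) \<le> Sup {ereal (real n) | n. \<exists>P. prime_chain ?R n P \<and> ?I \<subseteq> P 0}"
      using P(1) unfolding card_W by (intro Sup_upper) blast
  qed
  \<comment> \<open>Since \<open>1 \<le> k\<close>, the natural subtraction agrees with the real
    one.\<close>
  also have "\<dots> = ereal (real CARD('v) / 2 + real k - 1)"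
    using k by (simp add: card_C[symmetric] of_nat_diff)
  finally show "krull_dim (?R Quot ?I) = ereal (real CARD('v) / 2 + real k - 1)" .
qed

end
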